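(* Let $G$ be a connected graph and let $\mathcal{C}(G)$ denote the set of minimal edge cuts of $G$. Then $$\gamma_g(G) \le \min_{C\in \mathcal{C}(G)}\{\gamma_g(G\setminus C) + 2|C|\},$$ that is, $\gamma_g(G)\le \gamma_g(G\setminus C)+2|C|$ for every minimal edge cut $C$ of $G$.
   Context: Graphs are finite and simple. A vertex $x$ dominates every vertex of its closed neighborhood $N[x]$ ($x$ together with its neighbors). The domination game on a graph $G$ is played by Dominator and Staller, who take turns choosing a vertex of $G$ such that at least one previously undominated vertex becomes dominated. The game is over when all vertices of $G$ are dominated. Dominator wants to minimize the number of vertices played, Staller wants to maximize it. In the D-game Dominator has the first move, and $\gamma_g(G)$ (the game domination number) is the number of moves played in the D-game when both players play optimally. The graph $G$ need not be connected. An edge cut of a connected graph $G$ is a set $C$ of edges such that $G\setminus C$ is disconnected, where $G\setminus C$ denotes the graph obtained from $G$ by deleting the edges in $C$ (keeping all vertices). An edge cut is minimal if no proper subset of it is an edge cut. *)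

theory Defs
  imports "Graph_Theory.Digraph_Component"
begin

text \<open>
  A finite simple graph is a \<^locale>\<open>pair_graph\<close>: each undirected edge is represented by its two
  opposite arcs. Edges, and hence edge cuts and their cardinalities, are taken to be two-element
  vertex sets, so that an edge is counted once.
\<close>

definition edges :: "'a pair_pre_digraph \<Rightarrow> 'a set set" where
  "edges G = {{u, v} | u v. (u, v) \<in> parcs G}"

definition delete_edges :: "'a pair_pre_digraph \<Rightarrow> 'a set set \<Rightarrow> 'a pair_pre_digraph" where
  "delete_edges G C = G\<lparr>parcs := {(u, v) \<in> parcs G. {u, v} \<notin> C}\<rparr>"

lemma pair_graph_delete_edges:
  assumes "pair_graph G"
  shows "pair_graph (delete_edges G C)"
proof -
  interpret pair_graph G by fact
  show ?thesis
  proof unfold_locales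
    show "finite (pverts (delete_edges G C))" by (simp add: delete_edges_def)
    show "finite (parcs (delete_edges G C))"
      by (rule finite_subset[OF _ pair_finite_arcs]) (auto simp: delete_edges_def)
    show "symmetric (delete_edges G C)"
      using pair_sym_arcs unfolding symmetric_def sym_def
      by (auto simp: delete_edges_def insert_commute arcs_ends_def arc_to_ends_def)
  qed (auto simp: delete_edges_def dest: pair_no_loops arc_fst_in_verts arc_snd_in_verts)
qed

lemma edges_delete_edges: "edges (delete_edges G C) = edges G - C"
  by (auto simp: edges_def delete_edges_def)

definition edge_cut :: "'a pair_pre_digraph \<Rightarrow> 'a set set \<Rightarrow> bool" where
  "edge_cut G C \<longleftrightarrow> C \<subseteq> edges G \<and> \<not> connected (delete_edges G C)"

definition minimal_edge_cuts :: "'a pair_pre_digraph \<Rightarrow> 'a set set set" where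
  "minimal_edge_cuts G = {C. edge_cut G C \<and> (\<forall>C'. C' \<subset> C \<longrightarrow> \<not> edge_cut G C')}"

definition closed_neighborhood :: "'a pair_pre_digraph \<Rightarrow> 'a \<Rightarrow> 'a set" where
  "closed_neighborhood G v = {u \<in> pverts G. u = v \<or> (v, u) \<in> parcs G}"

definition playable :: "'a pair_pre_digraph \<Rightarrow> 'a set \<Rightarrow> 'a set" where
  "playable G D = {v \<in> pverts G. \<not> closed_neighborhood G v \<subseteq> D}"

datatype player = Dominator | Staller

fun opponent :: "player \<Rightarrow> player" where
  "opponent Dominator = Staller"
| "opponent Staller = Dominator"

text \<open>
  Minimax value: the number of moves still to be played under optimal play when player \<open>p\<close> is to
  move and \<open>D\<close> is the set of vertices dominated so far. The infinite case only serves to make the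
  function total. \<open>Min\<close> and \<open>Max\<close> are never applied to an empty set, since every undominated vertex
  is playable (see \<open>playable_nonempty\<close> below).
\<close>

function moves_left :: "'a pair_pre_digraph \<Rightarrow> player \<Rightarrow> 'a set \<Rightarrow> nat" where
  "moves_left G p D =
    (if infinite (pverts G) \<or> pverts G \<subseteq> D then 0
     else 1 + (case p of Dominator \<Rightarrow> Min | Staller \<Rightarrow> Max)
                ((\<lambda>v. moves_left G (opponent p) (D \<union> closed_neighborhood G v)) ` playable G D))"
  by auto
termination
proof (relation "measure (\<lambda>(G, p, D). card (pverts G - D))")
  fix G :: "'a pair_pre_digraph" and p D v
  assume "\<not> (infinite (pverts G) \<or> pverts G \<subseteq> D)" and "v \<in> playable G D"
  then have "pverts G - (D \<union> closed_neighborhood G v) \<subset> pverts G - D"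
    and "finite (pverts G - D)"
    by (auto simp: playable_def closed_neighborhood_def)
  then show "((G, opponent p, D \<union> closed_neighborhood G v), (G, p, D))
      \<in> measure (\<lambda>(G, p, D). card (pverts G - D))"
    by (simp add: psubset_card_mono)
qed simp

declare moves_left.simps [simp del]

lemma playable_nonempty: "\<not> pverts G \<subseteq> D \<Longrightarrow> playable G D \<noteq> {}"
  by (auto simp: playable_def closed_neighborhood_def)

definition game_domination_number :: "'a pair_pre_digraph \<Rightarrow> nat" where
  "game_domination_number G = moves_left G Dominator {}"

end

theory Submission
  imports Defs
begin

text \<open>
  Deleting one edge \<open>uv\<close> lowers the game domination number by at most two; deleting the edges of
  \<open>C\<close> one at a time gives the bound. For a single edge, Dominator plays
  on \<open>G\<close> as he would on \<open>G - uv\<close>, with the same set of dominated vertices. By the continuation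
  principle (dominating more vertices never prolongs the game), extra vertices dominated in \<open>G\<close> can
  be forgotten. The simulation only breaks down when Staller plays one end of \<open>uv\<close> solely to
  dominate the other end; from then on both ends are dominated, the edge is irrelevant, and Staller
  has gained that move and at most one more by passing the turn.
\<close>

lemma moves_left_full: "pverts G \<subseteq> D \<Longrightarrow> moves_left G p D = 0"
  by (subst moves_left.simps) simp

lemma finite_playable: "finite (pverts G) \<Longrightarrow> finite (playable G D)"
  by (simp add: playable_def)

lemma playable_not_full: "v \<in> playable G D \<Longrightarrow> \<not> pverts G \<subseteq> D"
  by (auto simp: playable_def closed_neighborhood_def)

lemma moves_left_Dominator_le:
  assumes "finite (pverts G)" and "v \<in> playable G D"
  shows "moves_left G Dominator D \<le> Suc (moves_left G Staller (D \<union> closed_neighborhood G v))"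
  using assms finite_playable[OF assms(1)] playable_not_full[OF assms(2)]
  by (subst moves_left.simps) (auto intro!: Min_le)

lemma moves_left_DominatorE:
  assumes "finite (pverts G)" and "\<not> pverts G \<subseteq> D"
  obtains v where "v \<in> playable G D"
    and "moves_left G Dominator D = Suc (moves_left G Staller (D \<union> closed_neighborhood G v))"
proof -
  let ?f = "\<lambda>v. moves_left G Staller (D \<union> closed_neighborhood G v)"
  have "Min (?f ` playable G D) \<in> ?f ` playable G D"
    using assms by (intro Min_in) (auto simp: finite_playable playable_nonempty)
  moreover have "moves_left G Dominator D = Suc (Min (?f ` playable G D))"
    using assms by (subst moves_left.simps) simp
  ultimately show thesis using that by auto
qed

lemma moves_left_Staller_ge:
  assumes "finite (pverts G)" and "v \<in> playable G D"
  shows "Suc (moves_left G Dominator (D \<union> closed_neighborhood G v)) \<le> moves_left G Staller D"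
  using assms finite_playable[OF assms(1)] playable_not_full[OF assms(2)]
  by (subst (2) moves_left.simps) (auto intro!: Max_ge)

lemma moves_left_StallerE:
  assumes "finite (pverts G)" and "\<not> pverts G \<subseteq> D"
  obtains v where "v \<in> playable G D"
    and "moves_left G Staller D = Suc (moves_left G Dominator (D \<union> closed_neighborhood G v))"
proof -
  let ?f = "\<lambda>v. moves_left G Dominator (D \<union> closed_neighborhood G v)"
  have "Max (?f ` playable G D) \<in> ?f ` playable G D"
    using assms by (intro Max_in) (auto simp: finite_playable playable_nonempty)
  moreover have "moves_left G Staller D = Suc (Max (?f ` playable G D))"
    using assms by (subst moves_left.simps) simp
  ultimately show thesis using that by auto
qed

text \<open>The decreasing measure for the inductions below. A superset \<open>B\<close> of the
  position after the move is allowed, so that a move in one game may be compared with a position in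
  which further vertices are dominated.\<close>

lemma card_undominated_less:
  assumes "finite (pverts G)" and "v \<in> playable G D" and "D \<union> closed_neighborhood G v \<subseteq> B"
  shows "card (pverts G - B) < card (pverts G - D)"
  using assms by (intro psubset_card_mono) (auto simp: playable_def closed_neighborhood_def)

text \<open>An optimal Dominator move from \<open>A\<close> can be imitated from \<open>B\<close>,
  and every Staller move from \<open>B\<close> is already playable from \<open>A\<close>. The
  induction measures \<open>A\<close>, since in both cases the move considered is one that is
  playable from \<open>A\<close>.\<close>

lemma continuation_principle:
  assumes fin: "finite (pverts G)" and "A \<subseteq> B"
  shows "moves_left G p B \<le> moves_left G p A"
  using \<open>A \<subseteq> B\<close>
proof (induction "card (pverts G - A)" arbitrary: A B p rule: less_induct)
  case less
  show ?case
  proof (cases "pverts G \<subseteq> B")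
    case True
    then show ?thesis by (simp add: moves_left_full)
  next
    case False
    then have A: "\<not> pverts G \<subseteq> A" using less.prems by blast
    show ?thesis
    proof (cases p)
      case Dominator
      obtain v where v: "v \<in> playable G A"
        and eq: "moves_left G Dominator A = Suc (moves_left G Staller (A \<union> closed_neighborhood G v))"
        using moves_left_DominatorE[OF fin A] .
      have IH: "moves_left G Staller Y \<le> moves_left G Staller X"
        if "A \<union> closed_neighborhood G v \<subseteq> X" "X \<subseteq> Y" for X Y
        using less.hyps[OF card_undominated_less[OF fin v that(1)] that(2)] .
      \<comment> \<open>If \<open>v\<close> is no longer playable, any other move does, since all of \<open>A \<union> N[v]\<close> is dominated.\<close>
      obtain w where w: "w \<in> playable G B"
        and sub: "A \<union> closed_neighborhood G v \<subseteq> B \<union> closed_neighborhood G w"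
      proof (cases "v \<in> playable G B")
        case True
        then show ?thesis using less.prems by (intro that[of v]) auto
      next
        case nv: False
        obtain w where "w \<in> playable G B" using playable_nonempty[OF False] by blast
        moreover have "closed_neighborhood G v \<subseteq> B" using nv v by (auto simp: playable_def)
        ultimately show ?thesis using less.prems by (intro that[of w]) auto
      qed
      have "moves_left G Dominator B \<le> Suc (moves_left G Staller (B \<union> closed_neighborhood G w))"
        by (rule moves_left_Dominator_le[OF fin w])
      also have "\<dots> \<le> moves_left G Dominator A"
        using IH[OF order_refl sub] eq by simp
      finally show ?thesis using Dominator by simp
    next
      case Staller
      obtain v where v: "v \<in> playable G B"
        and eq: "moves_left G Staller B = Suc (moves_left G Dominator (B \<union> closed_neighborhood G v))"
        using moves_left_StallerE[OF fin False] .
      have v': "v \<in> playable G A" using v less.prems by (auto simp: playable_def)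
      have "moves_left G Dominator (B \<union> closed_neighborhood G v)
          \<le> moves_left G Dominator (A \<union> closed_neighborhood G v)"
        using less.hyps[OF card_undominated_less[OF fin v' order_refl]] less.prems by blast
      then show ?thesis using moves_left_Staller_ge[OF fin v'] eq Staller by simp
    qed
  qed
qed

text \<open>Bounds the cost to Dominator of having to move first: any playable move costs one turn,
  and the vertices it dominates do no harm by the continuation principle.\<close>

lemma moves_left_Dominator_le_Staller:
  assumes fin: "finite (pverts G)"
  shows "moves_left G Dominator D \<le> Suc (moves_left G Staller D)"
proof (cases "pverts G \<subseteq> D")
  case True
  then show ?thesis by (simp add: moves_left_full)
next
  case False
  obtain v where v: "v \<in> playable G D" using playable_nonempty[OF False] by blast
  have "moves_left G Staller (D \<union> closed_neighborhood G v) \<le> moves_left G Staller D"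
    by (rule continuation_principle[OF fin Un_upper1])
  then show ?thesis using moves_left_Dominator_le[OF fin v] by linarith
qed

lemma pverts_delete_edges [simp]: "pverts (delete_edges G C) = pverts G"
  by (simp add: delete_edges_def)

lemma delete_edges_empty [simp]: "delete_edges G {} = G"
  by (simp add: delete_edges_def)

lemma delete_edges_delete_edges: "delete_edges (delete_edges G C) C' = delete_edges G (C \<union> C')"
  by (auto simp: delete_edges_def)

lemma closed_neighborhood_delete_edges_subset:
  "closed_neighborhood (delete_edges G C) x \<subseteq> closed_neighborhood G x"
  by (auto simp: closed_neighborhood_def delete_edges_def)

lemma closed_neighborhood_subset_delete_edge:
  "closed_neighborhood G x \<subseteq> closed_neighborhood (delete_edges G {{u, v}}) x \<union> {u, v}"
  by (auto simp: closed_neighborhood_def delete_edges_def)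

text \<open>Lets Dominator copy into \<open>G\<close> the moves that are optimal after the
  deletion.\<close>

lemma playable_delete_edges_subset: "playable (delete_edges G C) D \<subseteq> playable G D"
  unfolding playable_def pverts_delete_edges
  by (rule Collect_mono) (meson closed_neighborhood_delete_edges_subset subset_trans)

text \<open>A move that is playable only thanks to the edge must be made at one of its ends. That
  end is already in \<open>D\<close>, as otherwise the move would be playable without the edge, and
  the other end lies in its closed neighborhood in \<open>G\<close>.\<close>

lemma ends_dominated_by_new_move:
  assumes "x \<in> playable G D" and "x \<notin> playable (delete_edges G {{u, v}}) D"
  shows "{u, v} \<subseteq> D \<union> closed_neighborhood G x"
  using assms by (auto simp: playable_def closed_neighborhood_def delete_edges_def doubleton_eq_iff)

lemma moves_left_delete_edge_ends_dominated:
  assumes "{u, v} \<subseteq> D"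
  shows "moves_left (delete_edges G {{u, v}}) p D = moves_left G p D"
  using assms
proof (induction G p D rule: moves_left.induct)
  case (1 G p D)
  let ?H = "delete_edges G {{u, v}}"
  \<comment> \<open>The closed neighborhoods themselves may differ, but only in \<open>u\<close> or
    \<open>v\<close>, which \<open>D\<close> absorbs.\<close>
  have cn: "D \<union> closed_neighborhood ?H x = D \<union> closed_neighborhood G x" for x
    using closed_neighborhood_subset_delete_edge[of G x u v]
      closed_neighborhood_delete_edges_subset[of G "{{u, v}}" x] "1.prems" by blast
  have "closed_neighborhood ?H x \<subseteq> D \<longleftrightarrow> closed_neighborhood G x \<subseteq> D" for x
    using cn[of x] by blast
  then have pl: "playable ?H D = playable G D" by (simp add: playable_def)
  show ?case
  proof (cases "infinite (pverts G) \<or> pverts G \<subseteq> D")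
    case True
    then show ?thesis
      by (subst moves_left.simps[of ?H], subst moves_left.simps[of G]) simp
  next
    case False
    have img: "(\<lambda>x. moves_left ?H (opponent p) (D \<union> closed_neighborhood ?H x)) ` playable ?H D
        = (\<lambda>x. moves_left G (opponent p) (D \<union> closed_neighborhood G x)) ` playable G D"
      unfolding pl cn using "1.IH"[OF False] "1.prems" by (intro image_cong) auto
    show ?thesis
      by (subst moves_left.simps[of ?H], subst moves_left.simps[of G], subst img) simp
  qed
qed

lemma moves_left_le_delete_edge:
  assumes fin: "finite (pverts G)"
  shows "moves_left G p D \<le> moves_left (delete_edges G {{u, v}}) p D + 2"
proof (induction "card (pverts G - D)" arbitrary: D p rule: less_induct)
  case less
  let ?H = "delete_edges G {{u, v}}"
  have finH: "finite (pverts ?H)" using fin by simp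
  \<comment> \<open>One round of the simulation: the vertices that \<open>x\<close> dominates only
    in \<open>G\<close> are forgotten, so both games continue from the same set and the induction
    hypothesis applies.\<close>
  have step: "moves_left G q (D \<union> closed_neighborhood G x)
      \<le> moves_left ?H q (D \<union> closed_neighborhood ?H x) + 2"
    if x: "x \<in> playable ?H D" for q x
  proof -
    have "moves_left G q (D \<union> closed_neighborhood G x) \<le> moves_left G q (D \<union> closed_neighborhood ?H x)"
      using closed_neighborhood_delete_edges_subset[of G "{{u, v}}" x]
      by (intro continuation_principle[OF fin]) auto
    also have "\<dots> \<le> moves_left ?H q (D \<union> closed_neighborhood ?H x) + 2"
      using less.hyps card_undominated_less[OF finH x order_refl] by simp
    finally show ?thesis .
  qed
  show ?case
  proof (cases "pverts G \<subseteq> D")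
    case True
    then show ?thesis by (simp add: moves_left_full)
  next
    case False
    then have H: "\<not> pverts ?H \<subseteq> D" by simp
    show ?thesis
    proof (cases p)
      case Dominator
      obtain x where x: "x \<in> playable ?H D"
        and eq: "moves_left ?H Dominator D = Suc (moves_left ?H Staller (D \<union> closed_neighborhood ?H x))"
        using moves_left_DominatorE[OF finH H] .
      have "x \<in> playable G D" by (rule subsetD[OF playable_delete_edges_subset x])
      from moves_left_Dominator_le[OF fin this] show ?thesis
        using step[OF x, of Staller] eq Dominator by simp
    next
      case Staller
      obtain x where x: "x \<in> playable G D"
        and eq: "moves_left G Staller D = Suc (moves_left G Dominator (D \<union> closed_neighborhood G x))"
        using moves_left_StallerE[OF fin False] .
      show ?thesis
      proof (cases "x \<in> playable ?H D")
        case True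
        from moves_left_Staller_ge[OF finH this] show ?thesis
          using step[OF True, of Dominator] eq Staller by simp
      next
        case nx: False
        \<comment> \<open>Here the allowance of 2 is spent: one for the move \<open>x\<close>, which
          has no counterpart in \<open>?H\<close>, and one because Dominator is now to move where
          Staller was to move in \<open>?H\<close>.\<close>
        have "moves_left G Dominator (D \<union> closed_neighborhood G x)
            = moves_left ?H Dominator (D \<union> closed_neighborhood G x)"
          using moves_left_delete_edge_ends_dominated[OF ends_dominated_by_new_move[OF x nx]] by simp
        also have "\<dots> \<le> moves_left ?H Dominator D"
          by (intro continuation_principle[OF finH]) auto
        also have "\<dots> \<le> Suc (moves_left ?H Staller D)"
          by (rule moves_left_Dominator_le_Staller[OF finH])
        finally show ?thesis using eq Staller by simp
      qed
    qed
  qed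
qed

lemma game_domination_number_le_delete_edges:
  assumes "finite (pverts G)" and "finite C" and "C \<subseteq> edges G"
  shows "game_domination_number G \<le> game_domination_number (delete_edges G C) + 2 * card C"
  using assms(2,3)
proof (induction C rule: finite_induct)
  case empty
  then show ?case by simp
next
  case (insert e C)
  \<comment> \<open>The inclusion in \<open>edges G\<close> is what gives \<open>e\<close> the form
    required by the bound for a single edge.\<close>
  then obtain u v where e: "e = {u, v}" by (auto simp: edges_def)
  have "game_domination_number (delete_edges G C)
      \<le> game_domination_number (delete_edges G (insert e C)) + 2"
    using moves_left_le_delete_edge[of "delete_edges G C" Dominator "{}" u v] assms(1)
    by (simp add: game_domination_number_def delete_edges_delete_edges e)
  with insert show ?case by simp
qed

theorem theorem3p1:
  fixes G :: "'a pair_pre_digraph" and C :: "'a set set"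
  assumes "pair_graph G" and "connected G" and "C \<in> minimal_edge_cuts G"
  shows "game_domination_number G \<le> game_domination_number (delete_edges G C) + 2 * card C"
proof -
  interpret pair_graph G by fact
  have C: "C \<subseteq> edges G" using assms(3) by (simp add: minimal_edge_cuts_def edge_cut_def)
  \<comment> \<open>Writing the edges as an image of the finite set of arcs makes \<open>C\<close>
    finite, as the induction over \<open>C\<close> requires.\<close>
  have "edges G = (\<lambda>(u, v). {u, v}) ` parcs G" by (auto simp: edges_def)
  then have "finite C" using C pair_finite_arcs by (auto intro: finite_subset)
  then show ?thesis using C by (intro game_domination_number_le_delete_edges) simp_all
qed

end
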